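(* Let $X_1,\ldots,X_n$ be i.i.d. with density $s$ on $[0,1]$, let $\{S_m\}_{m\in\mathcal M_n}$ be a collection of models with projection estimators $\widehat s_m$, and assume (SqI), (Pol), (RegD), (Dmax), (Rich), (LoEx), (Bias) and (OrSp) (all stated in the context). Let $(\delta_n)_n$, with $\delta_n\to0$ and $n\delta_n\to+\infty$, be the sequence of the oracle inequality $\|s-\widehat s_{\widehat m(p)}\|^2\le C_n(p)\inf_{m\in\mathcal M_n}\|s-\widehat s_m\|^2$ described in the context, where $$C_n(p)=\frac{T_B^+\vee T_V^+}{T_B^-\wedge T_V^-}\ge 1,$$ $$T_B^-=1-\delta_nK(n,p),\qquad T_V^-=\frac{1}{1-p/n}(1-\delta_n)(1-4\delta_n)-2\delta_nK(n,p)(3-4\delta_n),$$ $$T_B^+=1+\delta_nK(n,p),\qquad T_V^+=\frac{1}{1-p/n}(1+\delta_n)(1+4\delta_n)+2\delta_nK(n,p)(3+4\delta_n),$$ and $K(n,p)=1+\frac{2}{n-1}+\frac{p}{n-p}\frac1{n-1}$. Then, for $n$ large enough, the constant $C_n(p)$ is minimized over $p\in\{1,\ldots,n-1\}$ for $p=p_n^*$ such that $$0<\frac{p_n^*}{n}=1-\frac{1-5\delta_n+4\delta_n^2-\frac{2}{n-1}(3\delta_n-4\delta_n^2)+\frac{\delta_n}{n-1}}{1+2\big(1+\frac1{n-1}\big)(3\delta_n-4\delta_n^2)-\delta_n\big(1+\frac1{n-1}\big)}<1 .$$ Furthermore, the optimal ratio $p_n^*/n$ is slowly decreasing to $0$ as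 $n$ tends to $+\infty$: $$p_n^*\sim_{n\to+\infty}10\,n\,\delta_n\longrightarrow+\infty .$$
   Context: $\|\cdot\|$ is the norm of $L^2([0,1])$. For each $n$, $\mathcal M_n$ is a countable index set; for $m\in\mathcal M_n$, $\{\varphi_\lambda\}_{\lambda\in\Lambda(m)}$ is an orthonormal family in $L^2([0,1])$, $S_m$ its linear span, $D_m=\dim S_m$, $s_m$ the orthogonal projection of $s$ onto $S_m$, and $\phi_m=\sum_{\lambda\in\Lambda(m)}\varphi_\lambda^2$. The projection estimator is $\widehat s_m=\sum_{\lambda\in\Lambda(m)}\big(\frac1n\sum_{i=1}^n\varphi_\lambda(X_i)\big)\varphi_\lambda$, with risk $R_n(\widehat s_m)=\mathbb E[\|s-\widehat s_m\|^2]$. Leave-$p$-out: for $e\subset\{1,\ldots,n\}$ with $\mathrm{Card}(e)=p$, $\widehat s_m(X^{(e)})=\sum_{\lambda\in\Lambda(m)}\big(\frac1{n-p}\sum_{i\notin e}\varphi_\lambda(X_i)\big)\varphi_\lambda$, and with $\gamma(u;x)=\|u\|^2-2u(x)$, $\mathcal E_p=\{e\subset\{1,\ldots,n\}:\mathrm{Card}(e)=p\}$, $\widehat R_p(m)=\binom np^{-1}\sum_{e\in\mathcal E_p}\frac1p\sum_{i\in e}\gamma(\widehat s_m(X^{(e)});X_i)$. For every $p\in\{1,\ldots,n-1\}$, $\widehat m(p)$ is the minimizer of $\widehat R_p(m)$ over $\mathcal M_n$. Under the assumptions below, the sequence $(\delta_n)$ is one such that $\delta_n\to0$, $n\delta_n\to+\infty$,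 and there is an event of probability at least $1-6/n^2$ on which, for $n$ large enough, the oracle inequality $\|s-\widehat s_{\widehat m(p)}\|^2\le C_n(p)\inf_{m\in\mathcal M_n}\|s-\widehat s_m\|^2$ holds for every $p\in\{1,\ldots,n-1\}$. Assumptions (constants do not depend on $n$): (SqI) $s\in L^2([0,1])$. (Pol) There is $a_{\mathcal M}\ge0$ with $\mathrm{Card}(\mathcal M_n)\le n^{a_{\mathcal M}}$. (RegD) There is $\Phi>0$ with $\sup_{m\in\mathcal M_n}\|\phi_m\|_\infty/D_m\le\Phi$. (Dmax) $\sup_{m\in\mathcal M_n}D_m\le\Gamma\, n/(\log n)^2$, with $\Gamma=1$. (LoEx) There is $\xi>0$ with $\inf_{m\in\mathcal M_n}\sqrt n\,\mathbb E(\|s_m-\widehat s_m\|)/\sqrt{D_m}\ge\sqrt\xi$. (Rich) There exist $m_0\in\mathcal M_n$ and $c_{\mathrm{rich}}\ge1$ with $\sqrt n\le D_{m_0}\le c_{\mathrm{rich}}\sqrt n$. (Bias) There exist $c_\ell,c_u>0$ and $\ell>u>0$ such that $c_\ell D_m^{-\ell}\le\|s-s_m\|^2\le c_uD_m^{-u}$ for every $m\in\mathcal M_n$. (OrSp) $nR_n^*(\log n)^{-2}\to+\infty$ as $n\to\infty$, where $R_n^*=\inf_{m\in\mathcal M_n}R_n(\widehat s_m)$. *)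

theory Defs
  imports
    "HOL-Probability.Probability"
    "HOL-Library.Function_Algebras"
    "HOL-Library.Landau_Symbols"
begin

section \<open>The space $L^2([0,1])$\<close>

text \<open>
  Elements of $L^2([0,1])$ are represented by functions on the reals; only their values on
  $[0,1]$ enter the norm and the inner product. Point evaluations, as in the contrast below,
  refer to the chosen representatives.
\<close>

definition unit_leb :: "real measure" where
  "unit_leb = restrict_space lborel {0..1}"

definition L2 :: "(real \<Rightarrow> real) set" where
  "L2 = {f \<in> borel_measurable unit_leb. integrable unit_leb (\<lambda>x. (f x)\<^sup>2)}"

definition l2_inner :: "(real \<Rightarrow> real) \<Rightarrow> (real \<Rightarrow> real) \<Rightarrow> real" where
  "l2_inner f g = (LINT x|unit_leb. f x * g x)"

definition l2_norm :: "(real \<Rightarrow> real) \<Rightarrow> real" where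
  "l2_norm f = sqrt (l2_inner f f)"

definition orthonormal_family :: "('l \<Rightarrow> real \<Rightarrow> real) \<Rightarrow> 'l set \<Rightarrow> bool" where
  "orthonormal_family \<phi> L \<longleftrightarrow>
     (\<forall>l\<in>L. \<phi> l \<in> L2) \<and>
     (\<forall>l\<in>L. \<forall>k\<in>L. l2_inner (\<phi> l) (\<phi> k) = (if l = k then 1 else 0))"

text \<open>Real functions as a real vector space, giving access to the library's span and dimension.\<close>

interpretation fun_vs: vector_space "\<lambda>(c::real) (f :: real \<Rightarrow> real) x. c * f x"
  by unfold_locales (auto simp: fun_eq_iff algebra_simps)


section \<open>Models and projection estimators\<close>

definition model :: "('l \<Rightarrow> real \<Rightarrow> real) \<Rightarrow> 'l set \<Rightarrow> (real \<Rightarrow> real) set" where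
  "model \<phi> L = fun_vs.span (\<phi> ` L)"

definition model_dim :: "('l \<Rightarrow> real \<Rightarrow> real) \<Rightarrow> 'l set \<Rightarrow> nat" where
  "model_dim \<phi> L = fun_vs.dim (model \<phi> L)"

text \<open>
  The projection is unique as a function, not only almost everywhere, because elements of a
  span of an orthonormal family are determined by their coefficients.
\<close>

definition orth_proj :: "(real \<Rightarrow> real) set \<Rightarrow> (real \<Rightarrow> real) \<Rightarrow> real \<Rightarrow> real" where
  "orth_proj S f = (THE g. g \<in> S \<and> (\<forall>h\<in>S. l2_inner (\<lambda>x. f x - g x) h = 0))"

definition phi_sum :: "('l \<Rightarrow> real \<Rightarrow> real) \<Rightarrow> 'l set \<Rightarrow> real \<Rightarrow> real" where
  "phi_sum \<phi> L x = (\<Sum>l\<in>L. (\<phi> l x)\<^sup>2)"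

text \<open>
  The projection estimator built from the observations with index in \<open>I\<close>: \<open>I = {1..n}\<close> gives the
  full-sample estimator, \<open>I = {1..n} - e\<close> the leave-\<open>p\<close>-out one.
\<close>

definition proj_est ::
  "('l \<Rightarrow> real \<Rightarrow> real) \<Rightarrow> 'l set \<Rightarrow> nat set \<Rightarrow> (nat \<Rightarrow> real) \<Rightarrow> real \<Rightarrow> real" where
  "proj_est \<phi> L I obs =
     (\<lambda>x. \<Sum>l\<in>L. (1 / real (card I) * (\<Sum>i\<in>I. \<phi> l (obs i))) * \<phi> l x)"

definition loss ::
  "(real \<Rightarrow> real) \<Rightarrow> ('l \<Rightarrow> real \<Rightarrow> real) \<Rightarrow> 'l set \<Rightarrow> nat \<Rightarrow> (nat \<Rightarrow> real) \<Rightarrow> real" where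
  "loss s \<phi> L n obs = (l2_norm (\<lambda>x. s x - proj_est \<phi> L {1..n} obs x))\<^sup>2"

definition risk ::
  "'w measure \<Rightarrow> (nat \<Rightarrow> 'w \<Rightarrow> real) \<Rightarrow> (real \<Rightarrow> real) \<Rightarrow> ('l \<Rightarrow> real \<Rightarrow> real) \<Rightarrow> 'l set \<Rightarrow> nat \<Rightarrow> real"
  where
  "risk P X s \<phi> L n = (LINT \<omega>|P. loss s \<phi> L n (\<lambda>i. X i \<omega>))"


section \<open>Leave-\<open>p\<close>-out risk estimation\<close>

definition contrast :: "(real \<Rightarrow> real) \<Rightarrow> real \<Rightarrow> real" where
  "contrast u x = (l2_norm u)\<^sup>2 - 2 * u x"

definition lpo_risk ::
  "('l \<Rightarrow> real \<Rightarrow> real) \<Rightarrow> 'l set \<Rightarrow> nat \<Rightarrow> nat \<Rightarrow> (nat \<Rightarrow> real) \<Rightarrow> real" where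
  "lpo_risk \<phi> L n p obs =
     1 / real (n choose p) *
     (\<Sum>e \<in> {e. e \<subseteq> {1..n} \<and> card e = p}.
        1 / real p * (\<Sum>i\<in>e. contrast (proj_est \<phi> L ({1..n} - e) obs) (obs i)))"


section \<open>Assumptions on the collection of models\<close>

text \<open>
  \<open>M n\<close> is the index set of the \<open>n\<close>-th collection and \<open>\<Lambda> m\<close> the index set of the basis of model \<open>m\<close>.
  The bounds on the models are required for all sufficiently large \<open>n\<close>, with constants independent
  of \<open>n\<close>. Asking for them at every \<open>n\<close> would be contradictory: for \<open>n = 5\<close>, for instance,
  \<open>n / (ln n)\<^sup>2 < sqrt n\<close>, so that \<open>Dmax\<close> and \<open>Rich\<close> exclude each other.
\<close>

definition SqI :: "(real \<Rightarrow> real) \<Rightarrow> bool" where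
  "SqI s \<longleftrightarrow> s \<in> L2"

definition Pol :: "(nat \<Rightarrow> 'm set) \<Rightarrow> bool" where
  "Pol M \<longleftrightarrow>
     (\<exists>a\<ge>0. \<forall>\<^sub>F n in sequentially. finite (M n) \<and> real (card (M n)) \<le> real n powr a)"

definition RegD ::
  "(nat \<Rightarrow> 'm set) \<Rightarrow> ('m \<Rightarrow> 'l set) \<Rightarrow> ('l \<Rightarrow> real \<Rightarrow> real) \<Rightarrow> bool" where
  "RegD M \<Lambda> \<phi> \<longleftrightarrow>
     (\<exists>\<Phi>>0. \<forall>\<^sub>F n in sequentially. \<forall>m\<in>M n.
        esssup unit_leb (\<lambda>x. ereal \<bar>phi_sum \<phi> (\<Lambda> m) x\<bar>) / ereal (real (model_dim \<phi> (\<Lambda> m)))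
          \<le> ereal \<Phi>)"

definition Dmax ::
  "real \<Rightarrow> (nat \<Rightarrow> 'm set) \<Rightarrow> ('m \<Rightarrow> 'l set) \<Rightarrow> ('l \<Rightarrow> real \<Rightarrow> real) \<Rightarrow> bool" where
  "Dmax \<Gamma> M \<Lambda> \<phi> \<longleftrightarrow>
     (\<forall>\<^sub>F n in sequentially. \<forall>m\<in>M n.
        real (model_dim \<phi> (\<Lambda> m)) \<le> \<Gamma> * real n / (ln (real n))\<^sup>2)"

definition LoEx ::
  "'w measure \<Rightarrow> (nat \<Rightarrow> 'w \<Rightarrow> real) \<Rightarrow> (real \<Rightarrow> real) \<Rightarrow>
   (nat \<Rightarrow> 'm set) \<Rightarrow> ('m \<Rightarrow> 'l set) \<Rightarrow> ('l \<Rightarrow> real \<Rightarrow> real) \<Rightarrow> bool" where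
  "LoEx P X s M \<Lambda> \<phi> \<longleftrightarrow>
     (\<exists>\<xi>>0. \<forall>\<^sub>F n in sequentially. \<forall>m\<in>M n.
        sqrt (real n)
          * (LINT \<omega>|P. l2_norm (\<lambda>x. orth_proj (model \<phi> (\<Lambda> m)) s x
                                    - proj_est \<phi> (\<Lambda> m) {1..n} (\<lambda>i. X i \<omega>) x))
          / sqrt (real (model_dim \<phi> (\<Lambda> m))) \<ge> sqrt \<xi>)"

definition Rich ::
  "(nat \<Rightarrow> 'm set) \<Rightarrow> ('m \<Rightarrow> 'l set) \<Rightarrow> ('l \<Rightarrow> real \<Rightarrow> real) \<Rightarrow> bool" where
  "Rich M \<Lambda> \<phi> \<longleftrightarrow>
     (\<exists>c\<ge>1. \<forall>\<^sub>F n in sequentially. \<exists>m\<^sub>0\<in>M n.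
        sqrt (real n) \<le> real (model_dim \<phi> (\<Lambda> m\<^sub>0)) \<and>
        real (model_dim \<phi> (\<Lambda> m\<^sub>0)) \<le> c * sqrt (real n))"

definition Bias ::
  "(real \<Rightarrow> real) \<Rightarrow> (nat \<Rightarrow> 'm set) \<Rightarrow> ('m \<Rightarrow> 'l set) \<Rightarrow> ('l \<Rightarrow> real \<Rightarrow> real) \<Rightarrow> bool" where
  "Bias s M \<Lambda> \<phi> \<longleftrightarrow>
     (\<exists>c\<^sub>l>0. \<exists>c\<^sub>u>0. \<exists>l u. l > u \<and> u > 0 \<and>
       (\<forall>\<^sub>F n in sequentially. \<forall>m\<in>M n.
          c\<^sub>l * real (model_dim \<phi> (\<Lambda> m)) powr (- l)
            \<le> (l2_norm (\<lambda>x. s x - orth_proj (model \<phi> (\<Lambda> m)) s x))\<^sup>2 \<and>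
          (l2_norm (\<lambda>x. s x - orth_proj (model \<phi> (\<Lambda> m)) s x))\<^sup>2
            \<le> c\<^sub>u * real (model_dim \<phi> (\<Lambda> m)) powr (- u)))"

definition OrSp ::
  "'w measure \<Rightarrow> (nat \<Rightarrow> 'w \<Rightarrow> real) \<Rightarrow> (real \<Rightarrow> real) \<Rightarrow>
   (nat \<Rightarrow> 'm set) \<Rightarrow> ('m \<Rightarrow> 'l set) \<Rightarrow> ('l \<Rightarrow> real \<Rightarrow> real) \<Rightarrow> bool" where
  "OrSp P X s M \<Lambda> \<phi> \<longleftrightarrow>
     filterlim (\<lambda>n. real n * (INF m\<in>M n. risk P X s \<phi> (\<Lambda> m) n) / (ln (real n))\<^sup>2)
       at_top sequentially"


section \<open>The constant of the oracle inequality\<close>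

text \<open>
  Below \<open>d\<close> stands for $\delta_n$. The variable \<open>p\<close> is real, so that the constant can be evaluated
  at the optimal value of \<open>p\<close>, which need not be an integer.
\<close>

definition K_fun :: "nat \<Rightarrow> real \<Rightarrow> real" where
  "K_fun n p = 1 + 2 / (real n - 1) + p / (real n - p) * (1 / (real n - 1))"

definition TB_minus :: "real \<Rightarrow> nat \<Rightarrow> real \<Rightarrow> real" where
  "TB_minus d n p = 1 - d * K_fun n p"

definition TV_minus :: "real \<Rightarrow> nat \<Rightarrow> real \<Rightarrow> real" where
  "TV_minus d n p =
     1 / (1 - p / real n) * (1 - d) * (1 - 4 * d) - 2 * d * K_fun n p * (3 - 4 * d)"

definition TB_plus :: "real \<Rightarrow> nat \<Rightarrow> real \<Rightarrow> real" where
  "TB_plus d n p = 1 + d * K_fun n p"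

definition TV_plus :: "real \<Rightarrow> nat \<Rightarrow> real \<Rightarrow> real" where
  "TV_plus d n p =
     1 / (1 - p / real n) * (1 + d) * (1 + 4 * d) + 2 * d * K_fun n p * (3 + 4 * d)"

definition C_oracle :: "real \<Rightarrow> nat \<Rightarrow> real \<Rightarrow> real" where
  "C_oracle d n p =
     max (TB_plus d n p) (TV_plus d n p) / min (TB_minus d n p) (TV_minus d n p)"

text \<open>
  The property defining the sequence \<open>\<delta>\<close>: \<open>mhat n p\<close> is the model selected by leave-\<open>p\<close>-out from
  \<open>n\<close> observations.
\<close>

definition oracle_sequence ::
  "'w measure \<Rightarrow> (nat \<Rightarrow> 'w \<Rightarrow> real) \<Rightarrow> (real \<Rightarrow> real) \<Rightarrow>
   (nat \<Rightarrow> 'm set) \<Rightarrow> ('m \<Rightarrow> 'l set) \<Rightarrow> ('l \<Rightarrow> real \<Rightarrow> real) \<Rightarrow>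
   (nat \<Rightarrow> nat \<Rightarrow> 'w \<Rightarrow> 'm) \<Rightarrow> (nat \<Rightarrow> real) \<Rightarrow> bool" where
  "oracle_sequence P X s M \<Lambda> \<phi> mhat \<delta> \<longleftrightarrow>
     \<delta> \<longlonglongrightarrow> 0 \<and>
     filterlim (\<lambda>n. real n * \<delta> n) at_top sequentially \<and>
     (\<forall>\<^sub>F n in sequentially. \<exists>A\<in>sets P.
        measure P A \<ge> 1 - 6 / (real n)\<^sup>2 \<and>
        (\<forall>\<omega>\<in>A. \<forall>p\<in>{1..n - 1}.
           loss s \<phi> (\<Lambda> (mhat n p \<omega>)) n (\<lambda>i. X i \<omega>)
             \<le> C_oracle (\<delta> n) n (real p) * (INF m\<in>M n. loss s \<phi> (\<Lambda> m) n (\<lambda>i. X i \<omega>))))"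

end

theory Submission
  imports Defs "HOL-Real_Asymp.Real_Asymp"
begin

text \<open>
  Since \<open>\<delta> n\<close> tends to \<open>0\<close> while \<open>n * \<delta> n\<close> tends to infinity, the claim is a deterministic one about
  \<open>C_oracle d n p\<close> for small \<open>d > 0\<close> and large \<open>n\<close>.

  The point is to replace \<open>p\<close> by \<open>x = n / (n - p)\<close>, an increasing function of \<open>p\<close> with values in
  \<open>[1, n]\<close> for \<open>p \<le> n - 1\<close>. The factor \<open>K_fun n p\<close> is affine in \<open>x\<close> and stays bounded
  (\<open>K_fun_affine\<close>, \<open>K_fun_bounds\<close>), and hence all four of \<open>TB_minus\<close>, \<open>TV_minus\<close>, \<open>TB_plus\<close>,
  \<open>TV_plus\<close> are affine in \<open>x\<close>. The numerator of the constant is always \<open>TV_plus\<close>. In the denominator,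
  the increasing function \<open>TV_minus\<close> and the decreasing function \<open>TB_minus\<close> cross exactly once, at
  the \<open>x\<close> for which \<open>p = p_opt d n\<close> (\<open>TV_minus_le_TB_minus_iff\<close>):
  \<^item> up to the crossing the constant is \<open>TV_plus / TV_minus\<close>, a quotient of affine functions of \<open>x\<close>
    that decreases strictly (\<open>C_oracle_decreasing\<close>);
  \<^item> beyond it the constant is \<open>TV_plus / TB_minus\<close>, with increasing numerator and decreasing
    denominator (\<open>C_oracle_increasing\<close>).

  So the constant has a strict valley at \<open>p_opt d n\<close>, which makes this point the minimizer over the
  real interval and confines every integer minimizer to distance less than one from it.
  Finally \<open>p_opt d n = n * d * c\<close> with a factor \<open>c\<close> that tends to \<open>10\<close> (\<open>p_opt_eq\<close>), which gives
  the asymptotic behaviour and shows that \<open>p_opt\<close> eventually lies in \<open>[1, n - 1]\<close>.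
\<close>

section \<open>The oracle constant in the variable \<open>n / (n - p)\<close>\<close>

definition fold_ratio :: "nat \<Rightarrow> real \<Rightarrow> real" where
  "fold_ratio n p = 1 / (1 - p / real n)"

lemma fold_ratio_ge_1:
  assumes "0 \<le> p" "p < real n"
  shows "1 \<le> fold_ratio n p"
  using assms by (auto simp: fold_ratio_def field_simps)

lemma fold_ratio_strict_mono:
  assumes "p < q" "q < real n" "0 < n"
  shows "fold_ratio n p < fold_ratio n q"
  using assms by (auto simp: fold_ratio_def intro!: divide_strict_left_mono divide_strict_right_mono mult_pos_pos)

lemma K_fun_affine:
  assumes "p < real n" "2 \<le> n"
  shows "K_fun n p = 1 + 1 / (real n - 1) + 1 / (real n - 1) * fold_ratio n p"
proof -
  have *: "p / (real n - p) = fold_ratio n p - 1"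
    using assms by (auto simp: fold_ratio_def field_simps)
  show ?thesis
    unfolding K_fun_def * by (simp add: algebra_simps diff_divide_distrib add_divide_distrib)
qed

text \<open>
  Boundedness of \<open>K_fun\<close> rests on \<open>p \<le> n - 1\<close>: the ratio \<open>n / (n - p)\<close> may be as large as \<open>n\<close>, but
  it is damped by the factor \<open>1 / (n - 1)\<close>.
\<close>

lemma K_fun_bounds:
  assumes "0 \<le> p" "p \<le> real n - 1" "3 \<le> n"
  shows "1 \<le> K_fun n p" "K_fun n p \<le> 3"
proof -
  have "p / (real n - p) \<le> real n - 1"
  proof -
    have "0 \<le> real n * (real n - 1 - p)"
      using assms by simp
    then have "p \<le> (real n - 1) * (real n - p)"
      by (simp add: algebra_simps)
    then show ?thesis
      using assms by (simp add: pos_divide_le_eq)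
  qed
  then have "p / (real n - p) * (1 / (real n - 1)) \<le> 1"
    using assms by (simp add: pos_divide_le_eq mult.commute)
  moreover have "2 / (real n - 1) \<le> 1" "0 \<le> 2 / (real n - 1)"
    using assms by (simp_all add: pos_divide_le_eq)
  moreover have "0 \<le> p / (real n - p) * (1 / (real n - 1))"
    using assms by simp
  ultimately show "1 \<le> K_fun n p" "K_fun n p \<le> 3"
    unfolding K_fun_def by linarith+
qed

lemma K_fun_strict_mono:
  assumes "p < q" "q < real n" "2 \<le> n"
  shows "K_fun n p < K_fun n q"
  using assms fold_ratio_strict_mono[of p q n] by (simp add: K_fun_affine divide_strict_right_mono)

lemma TV_plus_affine:
  assumes "p < real n" "2 \<le> n"
  shows "TV_plus d n p =
    ((1 + d) * (1 + 4 * d) + 2 * d * (1 / (real n - 1)) * (3 + 4 * d)) * fold_ratio n p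
      + 2 * d * (3 + 4 * d) * (1 + 1 / (real n - 1))"
  unfolding TV_plus_def K_fun_affine[OF assms] fold_ratio_def[symmetric]
  by algebra

lemma TV_minus_affine:
  assumes "p < real n" "2 \<le> n"
  shows "TV_minus d n p =
    ((1 - d) * (1 - 4 * d) - 2 * d * (1 / (real n - 1)) * (3 - 4 * d)) * fold_ratio n p
      - 2 * d * (3 - 4 * d) * (1 + 1 / (real n - 1))"
  unfolding TV_minus_def K_fun_affine[OF assms] fold_ratio_def[symmetric]
  by algebra

text \<open>
  The positive quantity is the slope of \<open>TV_minus\<close> as a function of \<open>n / (n - p)\<close>. The threshold
  \<open>1 / 100\<close>, here and below, is one convenient meaning of \<open>d\<close> small: since \<open>K_fun n p \<le> 3\<close>, the terms
  linear in \<open>d\<close> sum to at most \<open>23 * d\<close>, well below the leading \<open>1\<close>.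
\<close>

lemma TV_minus_slope_pos:
  fixes d :: real
  assumes "0 < d" "d \<le> 1 / 100" "3 \<le> n"
  shows "0 < (1 - d) * (1 - 4 * d) - 2 * d * (1 / (real n - 1)) * (3 - 4 * d)"
proof -
  have "2 * d * (1 / (real n - 1)) * (3 - 4 * d) \<le> 2 * d * 1 * 3"
    using assms by (intro mult_mono) (auto simp: pos_divide_le_eq)
  moreover have "(1 - d) * (1 - 4 * d) = 1 - 5 * d + 4 * d * d"
    by (simp add: algebra_simps)
  moreover have "0 \<le> 4 * d * d"
    using assms by simp
  ultimately show ?thesis
    using assms by linarith
qed

lemma TB_minus_pos:
  assumes "0 < d" "d \<le> 1 / 100" "3 \<le> n" "0 \<le> p" "p \<le> real n - 1"
  shows "0 < TB_minus d n p"
proof -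
  have "d * K_fun n p \<le> 1 / 100 * 3"
    using assms K_fun_bounds[of p n] by (intro mult_mono) auto
  then show ?thesis
    by (simp add: TB_minus_def)
qed

lemma TV_minus_pos:
  assumes "0 < d" "d \<le> 1 / 100" "3 \<le> n" "0 \<le> p" "p \<le> real n - 1"
  shows "0 < TV_minus d n p"
proof -
  have "2 * d * K_fun n p * (3 - 4 * d) \<le> 2 * (1 / 100) * 3 * 3"
    using assms K_fun_bounds[of p n] by (intro mult_mono) auto
  moreover have "1 * (99 / 100) * (96 / 100) \<le> fold_ratio n p * (1 - d) * (1 - 4 * d)"
    using assms fold_ratio_ge_1[of p n] by (intro mult_mono) auto
  ultimately show ?thesis
    unfolding TV_minus_def fold_ratio_def[symmetric] by linarith
qed

lemma TB_plus_le_TV_plus: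
  assumes "0 < d" "3 \<le> n" "0 \<le> p" "p \<le> real n - 1"
  shows "TB_plus d n p \<le> TV_plus d n p"
proof -
  have "1 * 1 * 1 \<le> fold_ratio n p * (1 + d) * (1 + 4 * d)"
    using assms fold_ratio_ge_1[of p n] by (intro mult_mono) auto
  moreover have "d * K_fun n p * 1 \<le> d * K_fun n p * (2 * (3 + 4 * d))"
    using assms K_fun_bounds[of p n] by (intro mult_left_mono) auto
  ultimately show ?thesis
    unfolding TV_plus_def TB_plus_def fold_ratio_def[symmetric] by (simp add: algebra_simps)
qed

lemma TV_plus_pos:
  assumes "0 < d" "3 \<le> n" "0 \<le> p" "p \<le> real n - 1"
  shows "0 < TV_plus d n p"
proof -
  have "0 \<le> d * K_fun n p"
    using assms K_fun_bounds[of p n] by simp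
  then show ?thesis
    using TB_plus_le_TV_plus[OF assms] by (simp add: TB_plus_def)
qed

lemma TV_plus_strict_mono:
  assumes "0 < d" "3 \<le> n" "p < q" "q < real n"
  shows "TV_plus d n p < TV_plus d n q"
proof -
  have "0 < (1 + d) * (1 + 4 * d) + 2 * d * (1 / (real n - 1)) * (3 + 4 * d)"
    using assms by (intro add_pos_nonneg mult_pos_pos mult_nonneg_nonneg) auto
  then show ?thesis
    using assms fold_ratio_strict_mono[of p q n] by (simp add: TV_plus_affine)
qed

lemma TB_minus_strict_antimono:
  assumes "0 < d" "3 \<le> n" "p < q" "q < real n"
  shows "TB_minus d n q < TB_minus d n p"
  using assms K_fun_strict_mono[of p q n] by (simp add: TB_minus_def)

text \<open>
  \<open>TB_plus\<close> and \<open>TB_minus\<close> lie on opposite sides of \<open>1\<close>, which separates the maximum from the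
  minimum; the quotient is then at least \<open>1\<close> because the minimum is positive.
\<close>

lemma C_oracle_ge_1:
  assumes "0 < d" "d \<le> 1 / 100" "3 \<le> n" "0 \<le> p" "p \<le> real n - 1"
  shows "1 \<le> C_oracle d n p"
proof -
  have "0 \<le> d * K_fun n p"
    using assms K_fun_bounds[of p n] by simp
  then have "TB_minus d n p \<le> TB_plus d n p"
    by (simp add: TB_minus_def TB_plus_def)
  then have "min (TB_minus d n p) (TV_minus d n p) \<le> max (TB_plus d n p) (TV_plus d n p)"
    by linarith
  moreover have "0 < min (TB_minus d n p) (TV_minus d n p)"
    using TB_minus_pos[OF assms] TV_minus_pos[OF assms] by simp
  ultimately show ?thesis
    by (simp add: C_oracle_def)
qed

lemma C_oracle_eq:
  assumes "0 < d" "3 \<le> n" "0 \<le> p" "p \<le> real n - 1"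
  shows "C_oracle d n p = TV_plus d n p / min (TB_minus d n p) (TV_minus d n p)"
  using TB_plus_le_TV_plus[OF assms] by (simp add: C_oracle_def max_absorb2)


section \<open>The crossing point and the valley of the oracle constant\<close>

text \<open>
  At the crossing \<open>TV_minus = TB_minus\<close> one has \<open>n / (n - p) = crossing_den d n / crossing_num d n\<close>;
  numerator and denominator are named after their place in \<open>1 - p / n\<close>.
\<close>

definition crossing_num :: "real \<Rightarrow> nat \<Rightarrow> real" where
  "crossing_num d n =
     1 - 5 * d + 4 * d\<^sup>2 - 2 / (real n - 1) * (3 * d - 4 * d\<^sup>2) + d / (real n - 1)"

definition crossing_den :: "real \<Rightarrow> nat \<Rightarrow> real" where
  "crossing_den d n =
     1 + 2 * (1 + 1 / (real n - 1)) * (3 * d - 4 * d\<^sup>2) - d * (1 + 1 / (real n - 1))"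

definition p_opt :: "real \<Rightarrow> nat \<Rightarrow> real" where
  "p_opt d n = real n * (1 - crossing_num d n / crossing_den d n)"

lemma crossing_num_pos:
  assumes "0 < d" "d \<le> 1 / 100" "3 \<le> n"
  shows "0 < crossing_num d n"
proof -
  have "crossing_num d n =
      (1 - d) * (1 - 4 * d) - 2 * d * (1 / (real n - 1)) * (3 - 4 * d) + d / (real n - 1)"
    by (simp add: crossing_num_def algebra_simps power2_eq_square diff_divide_distrib)
  moreover have "0 < d / (real n - 1)"
    using assms by simp
  ultimately show ?thesis
    using TV_minus_slope_pos[OF assms] by linarith
qed

lemma crossing_den_pos:
  assumes "0 < d" "d \<le> 1 / 100" "3 \<le> n"
  shows "0 < crossing_den d n"
proof -
  have "crossing_den d n = 1 + (1 + 1 / (real n - 1)) * (d * (5 - 8 * d))"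
    unfolding crossing_den_def by algebra
  also have "0 < \<dots>"
    using assms by (intro add_pos_nonneg mult_nonneg_nonneg) auto
  finally show ?thesis .
qed

lemma TV_minus_minus_TB_minus:
  assumes "p < real n" "2 \<le> n"
  shows "TV_minus d n p - TB_minus d n p = crossing_num d n * fold_ratio n p - crossing_den d n"
  unfolding TV_minus_affine[OF assms] TB_minus_def K_fun_affine[OF assms]
    crossing_num_def crossing_den_def
  by (simp add: algebra_simps power2_eq_square add_divide_distrib diff_divide_distrib)

lemma TV_minus_le_TB_minus_iff:
  assumes "0 < d" "d \<le> 1 / 100" "3 \<le> n" "p < real n"
  shows "TV_minus d n p \<le> TB_minus d n p \<longleftrightarrow> p \<le> p_opt d n"
proof -
  have "TV_minus d n p \<le> TB_minus d n p \<longleftrightarrow> crossing_num d n * fold_ratio n p \<le> crossing_den d n"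
    using TV_minus_minus_TB_minus[of p n d] assms by linarith
  also have "\<dots> \<longleftrightarrow> crossing_num d n / crossing_den d n \<le> 1 - p / real n"
    using assms crossing_den_pos[OF assms(1-3)] by (simp add: fold_ratio_def field_simps)
  also have "\<dots> \<longleftrightarrow> p / real n \<le> 1 - crossing_num d n / crossing_den d n"
    by linarith
  also have "\<dots> \<longleftrightarrow> p \<le> p_opt d n"
    using assms by (simp add: p_opt_def pos_divide_le_eq mult.commute)
  finally show ?thesis .
qed

text \<open>
  The difference of the two cross products is \<open>(a * b' + b * a') * (y - x)\<close>: adding a positive
  amount to the numerator and removing one from the denominator weighs less as \<open>x\<close> grows.
\<close>

lemma affine_quotient_strict_antimono:
  fixes a b a' b' x y :: real
  assumes "0 < a" "0 < b" "0 < a'" "0 < b'" "x < y" "0 < a' * x - b'"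
  shows "(a * y + b) / (a' * y - b') < (a * x + b) / (a' * x - b')"
proof -
  have "0 < (a * b' + b * a') * (y - x)"
    using assms by (intro mult_pos_pos add_pos_pos) auto
  also have "\<dots> = (a * x + b) * (a' * y - b') - (a * y + b) * (a' * x - b')"
    by (simp add: algebra_simps)
  finally have "(a * y + b) * (a' * x - b') < (a * x + b) * (a' * y - b')"
    by simp
  moreover have "0 < a' * y - b'"
    using assms mult_strict_left_mono[of x y a'] by linarith
  ultimately show ?thesis
    using assms by (simp add: divide_less_eq less_divide_eq mult.commute)
qed

lemma C_oracle_decreasing:
  assumes d: "0 < d" "d \<le> 1 / 100" "3 \<le> n"
    and pq: "0 \<le> p" "p < q" "q \<le> p_opt d n" "q \<le> real n - 1"
  shows "C_oracle d n q < C_oracle d n p"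
proof -
  have C: "C_oracle d n r = TV_plus d n r / TV_minus d n r"
    if "0 \<le> r" "r \<le> q" for r
    using that assms TV_minus_le_TB_minus_iff[of d n r] by (simp add: C_oracle_eq min_absorb2)
  have "TV_plus d n q / TV_minus d n q < TV_plus d n p / TV_minus d n p"
    using assms TV_minus_pos[of d n p] TV_minus_slope_pos[OF d] fold_ratio_strict_mono[of p q n]
      TV_minus_affine[of p n d] TV_minus_affine[of q n d]
      TV_plus_affine[of p n d] TV_plus_affine[of q n d]
    by (simp only:) (rule affine_quotient_strict_antimono;
        auto intro!: add_pos_nonneg mult_pos_pos mult_nonneg_nonneg)
  then show ?thesis
    using pq C[of p] C[of q] by simp
qed

lemma C_oracle_increasing:
  assumes d: "0 < d" "d \<le> 1 / 100" "3 \<le> n"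
    and pq: "0 \<le> p" "p_opt d n \<le> p" "p < q" "q \<le> real n - 1"
  shows "C_oracle d n p < C_oracle d n q"
proof -
  have C: "C_oracle d n r = TV_plus d n r / TB_minus d n r"
    if "p \<le> r" "r \<le> q" for r
  proof -
    \<comment> \<open>At \<open>r = p_opt d n\<close> both bounds agree; the strict comparison covers only larger \<open>r\<close>.\<close>
    have "TB_minus d n r \<le> TV_minus d n r"
    proof (cases "r = p_opt d n")
      case True
      have "real n * (1 - crossing_num d n / crossing_den d n) / real n
          = 1 - crossing_num d n / crossing_den d n"
        using d by simp
      then have "fold_ratio n r = crossing_den d n / crossing_num d n"
        unfolding True fold_ratio_def p_opt_def by simp
      then show ?thesis
        using TV_minus_minus_TB_minus[of r n d] that pq d crossing_num_pos[OF d] by simp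
    next
      case False
      then show ?thesis
        using TV_minus_le_TB_minus_iff[OF d, of r] that pq by auto
    qed
    then show ?thesis
      using that d pq by (simp add: C_oracle_eq min_absorb1)
  qed
  have "TV_plus d n p / TB_minus d n p < TV_plus d n q / TB_minus d n q"
    using assms TV_plus_pos[of d n p] TB_minus_pos[of d n q] TV_plus_strict_mono[of d n p q]
      TB_minus_strict_antimono[of d n p q]
    by (intro frac_less2) auto
  then show ?thesis
    using pq C[of p] C[of q] by simp
qed

text \<open>Integer minimizers are compared with their neighbour on the side of the valley's bottom.\<close>

lemma C_oracle_valley:
  assumes d: "0 < d" "d \<le> 1 / 100" "3 \<le> n"
    and p_opt: "1 \<le> p_opt d n" "p_opt d n \<le> real n - 1"
  shows "is_arg_min (C_oracle d n) (\<lambda>p. p \<in> {1..real n - 1}) (p_opt d n)"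
    and "\<lbrakk>q \<in> {1..n - 1}; is_arg_min (\<lambda>p. C_oracle d n (real p)) (\<lambda>p. p \<in> {1..n - 1}) q\<rbrakk>
      \<Longrightarrow> \<bar>real q - p_opt d n\<bar> < 1"
proof -
  have "C_oracle d n (p_opt d n) \<le> C_oracle d n p" if "p \<in> {1..real n - 1}" for p
    using that p_opt C_oracle_decreasing[OF d, of p "p_opt d n"]
      C_oracle_increasing[OF d, of "p_opt d n" p]
    by (cases p "p_opt d n" rule: linorder_cases) auto
  then show "is_arg_min (C_oracle d n) (\<lambda>p. p \<in> {1..real n - 1}) (p_opt d n)"
    using p_opt by (auto simp: is_arg_min_def not_less)
next
  assume q: "q \<in> {1..n - 1}"
    and min: "is_arg_min (\<lambda>p. C_oracle d n (real p)) (\<lambda>p. p \<in> {1..n - 1}) q"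
  show "\<bar>real q - p_opt d n\<bar> < 1"
  proof (rule ccontr)
    assume "\<not> \<bar>real q - p_opt d n\<bar> < 1"
    then consider "real q + 1 \<le> p_opt d n" | "p_opt d n \<le> real q - 1"
      by linarith
    then show False
    proof cases
      case 1
      then have "C_oracle d n (real (q + 1)) < C_oracle d n (real q)"
        using p_opt by (intro C_oracle_decreasing[OF d]) auto
      moreover have "q + 1 \<in> {1..n - 1}"
        using 1 p_opt q by auto
      ultimately show False
        using min unfolding is_arg_min_def by blast
    next
      case 2
      then have "C_oracle d n (real (q - 1)) < C_oracle d n (real q)"
        using p_opt q by (intro C_oracle_increasing[OF d]) (auto simp: of_nat_diff)
      moreover have "q - 1 \<in> {1..n - 1}"
        using 2 p_opt q by auto
      ultimately show False
        using min unfolding is_arg_min_def by blast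
    qed
  qed
qed


section \<open>Asymptotics of the crossing point\<close>

lemma p_opt_eq:
  assumes "crossing_den d n \<noteq> 0"
  shows "p_opt d n =
    real n * d * ((10 - 12 * d + 2 * (1 / (real n - 1)) * (5 - 8 * d)) / crossing_den d n)"
proof -
  have "crossing_den d n - crossing_num d n =
      d * (10 - 12 * d + 2 * (1 / (real n - 1)) * (5 - 8 * d))"
    by (simp add: crossing_den_def crossing_num_def algebra_simps power2_eq_square
        diff_divide_distrib add_divide_distrib)
  moreover have "1 - crossing_num d n / crossing_den d n =
      (crossing_den d n - crossing_num d n) / crossing_den d n"
    using assms by (simp add: diff_divide_distrib)
  ultimately show ?thesis
    by (simp add: p_opt_def)
qed

lemma inverse_pred_tendsto_0: "(\<lambda>n. 1 / (real n - 1)) \<longlonglongrightarrow> 0"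
  by real_asymp

lemma p_opt_factor_tendsto:
  assumes "\<delta> \<longlonglongrightarrow> 0"
  shows "(\<lambda>n. (10 - 12 * \<delta> n + 2 * (1 / (real n - 1)) * (5 - 8 * \<delta> n)) / crossing_den (\<delta> n) n)
    \<longlonglongrightarrow> 10"
proof -
  have "(\<lambda>n. (10 - 12 * \<delta> n + 2 * (1 / (real n - 1)) * (5 - 8 * \<delta> n)) / crossing_den (\<delta> n) n)
    \<longlonglongrightarrow> (10 - 12 * 0 + 2 * 0 * (5 - 8 * 0)) / (1 + 2 * (1 + 0) * (3 * 0 - 4 * 0\<^sup>2) - 0 * (1 + 0))"
    unfolding crossing_den_def
    by (intro tendsto_intros assms inverse_pred_tendsto_0) simp
  then show ?thesis
    by simp
qed

theorem corollary3p1: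
  fixes P :: "'w measure" and X :: "nat \<Rightarrow> 'w \<Rightarrow> real" and s :: "real \<Rightarrow> real"
    and M :: "nat \<Rightarrow> 'm set" and \<Lambda> :: "'m \<Rightarrow> 'l set" and \<phi> :: "'l \<Rightarrow> real \<Rightarrow> real"
    and mhat :: "nat \<Rightarrow> nat \<Rightarrow> 'w \<Rightarrow> 'm" and \<delta> :: "nat \<Rightarrow> real"
  assumes "prob_space P"
    and s_nonneg: "\<forall>x\<in>{0..1}. 0 \<le> s x"
    and density: "\<forall>i\<ge>1. distributed P unit_leb (X i) (\<lambda>x. ennreal (s x))"
    and indep: "prob_space.indep_vars P (\<lambda>_. unit_leb) X {1..}"
    and "\<forall>n. countable (M n)"
    and models: "\<forall>n. \<forall>m\<in>M n. finite (\<Lambda> m) \<and> \<Lambda> m \<noteq> {} \<and> orthonormal_family \<phi> (\<Lambda> m)"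
    and "SqI s"
    and "Pol M"
    and "RegD M \<Lambda> \<phi>"
    and "Dmax 1 M \<Lambda> \<phi>"
    and "Rich M \<Lambda> \<phi>"
    and "LoEx P X s M \<Lambda> \<phi>"
    and "Bias s M \<Lambda> \<phi>"
    and "OrSp P X s M \<Lambda> \<phi>"
    and mhat: "\<forall>\<^sub>F n in sequentially. \<forall>p\<in>{1..n - 1}. \<forall>\<omega>\<in>space P.
      is_arg_min (\<lambda>m. lpo_risk \<phi> (\<Lambda> m) n p (\<lambda>i. X i \<omega>)) (\<lambda>m. m \<in> M n) (mhat n p \<omega>)"
    and "oracle_sequence P X s M \<Lambda> \<phi> mhat \<delta>"
  shows "(\<forall>\<^sub>F n in sequentially. \<forall>p\<in>{1..n - 1}. C_oracle (\<delta> n) n (real p) \<ge> 1) \<and>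
    (\<exists>pstar :: nat \<Rightarrow> real.
      (\<forall>\<^sub>F n in sequentially.
        is_arg_min (C_oracle (\<delta> n) n) (\<lambda>p. p \<in> {1..real n - 1}) (pstar n) \<and>
        (\<forall>q\<in>{1..n - 1}.
           is_arg_min (\<lambda>p. C_oracle (\<delta> n) n (real p)) (\<lambda>p. p \<in> {1..n - 1}) q
             \<longrightarrow> \<bar>real q - pstar n\<bar> < 1) \<and>
        0 < pstar n / real n \<and>
        pstar n / real n =
          1 - (1 - 5 * \<delta> n + 4 * (\<delta> n)\<^sup>2 - 2 / (real n - 1) * (3 * \<delta> n - 4 * (\<delta> n)\<^sup>2)
                 + \<delta> n / (real n - 1))
              / (1 + 2 * (1 + 1 / (real n - 1)) * (3 * \<delta> n - 4 * (\<delta> n)\<^sup>2)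
                 - \<delta> n * (1 + 1 / (real n - 1))) \<and>
        pstar n / real n < 1) \<and>
      (\<lambda>n. pstar n / real n) \<longlonglongrightarrow> 0 \<and>
      pstar \<sim>[sequentially] (\<lambda>n. 10 * real n * \<delta> n) \<and>
      filterlim pstar at_top sequentially)"
proof -
  have \<delta>_0: "\<delta> \<longlonglongrightarrow> 0" and n\<delta>: "filterlim (\<lambda>n. real n * \<delta> n) at_top sequentially"
    using \<open>oracle_sequence P X s M \<Lambda> \<phi> mhat \<delta>\<close> by (auto simp: oracle_sequence_def)
  define pstar where "pstar n = p_opt (\<delta> n) n" for n
  define c where
    "c n = (10 - 12 * \<delta> n + 2 * (1 / (real n - 1)) * (5 - 8 * \<delta> n)) / crossing_den (\<delta> n) n" for n
  have c: "c \<longlonglongrightarrow> 10"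
    unfolding c_def by (rule p_opt_factor_tendsto[OF \<delta>_0])

  have ev_n: "\<forall>\<^sub>F n in sequentially. 3 \<le> n"
    by (rule eventually_ge_at_top)
  \<comment> \<open>Positivity of \<open>\<delta> n\<close> is a consequence of the divergence of \<open>n * \<delta> n\<close>.\<close>
  have ev_pos: "\<forall>\<^sub>F n in sequentially. 0 < \<delta> n"
    using filterlim_at_top_dense[THEN iffD1, OF n\<delta>, rule_format, of 0]
    by eventually_elim (auto simp: zero_less_mult_iff)
  have ev_small: "\<forall>\<^sub>F n in sequentially. \<delta> n \<le> 1 / 100"
    using order_tendstoD(2)[OF \<delta>_0, of "1 / 100"] by (auto elim: eventually_mono)
  have ev_eq: "\<forall>\<^sub>F n in sequentially. pstar n = real n * \<delta> n * c n"
    using ev_n ev_pos ev_small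
  proof eventually_elim
    case (elim n)
    then show ?case
      using crossing_den_pos[of "\<delta> n" n] by (simp add: pstar_def c_def p_opt_eq)
  qed

  have pstar_top: "filterlim pstar at_top sequentially"
  proof -
    have "filterlim (\<lambda>n. real n * \<delta> n * c n) at_top sequentially"
      by (rule filterlim_at_top_mult_tendsto_pos[OF c _ n\<delta>]) simp
    then show ?thesis
      using filterlim_cong[OF refl refl ev_eq] by simp
  qed
  have ratio_0: "(\<lambda>n. pstar n / real n) \<longlonglongrightarrow> 0"
  proof -
    have "(\<lambda>n. \<delta> n * c n) \<longlonglongrightarrow> 0 * 10"
      by (intro tendsto_mult \<delta>_0 c)
    moreover have "\<forall>\<^sub>F n in sequentially. \<delta> n * c n = pstar n / real n"
      using ev_eq ev_n by eventually_elim simp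
    ultimately have "(\<lambda>n. pstar n / real n) \<longlonglongrightarrow> 0 * 10"
      by (rule Lim_transform_eventually)
    then show ?thesis
      by simp
  qed
  have equiv: "pstar \<sim>[sequentially] (\<lambda>n. 10 * real n * \<delta> n)"
  proof (rule asymp_equivI')
    have "(\<lambda>n. c n / 10) \<longlonglongrightarrow> 10 / 10"
      by (intro tendsto_divide c tendsto_const) simp
    moreover have "\<forall>\<^sub>F n in sequentially. c n / 10 = pstar n / (10 * real n * \<delta> n)"
      using ev_eq ev_n ev_pos by eventually_elim simp
    ultimately have "(\<lambda>n. pstar n / (10 * real n * \<delta> n)) \<longlonglongrightarrow> 10 / 10"
      by (rule Lim_transform_eventually)
    then show "(\<lambda>n. pstar n / (10 * real n * \<delta> n)) \<longlonglongrightarrow> 1"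
      by simp
  qed

  have ev_ge: "\<forall>\<^sub>F n in sequentially. 1 \<le> pstar n"
    using pstar_top by (auto simp: filterlim_at_top)
  have ev_le: "\<forall>\<^sub>F n in sequentially. pstar n \<le> real n - 1"
  proof -
    have "\<forall>\<^sub>F n in sequentially. pstar n / real n < 1 / 2"
      by (rule order_tendstoD(2)[OF ratio_0]) simp
    then show ?thesis
      using ev_n by eventually_elim (simp add: pos_divide_less_eq)
  qed

  have "\<forall>\<^sub>F n in sequentially. \<forall>p\<in>{1..n - 1}. C_oracle (\<delta> n) n (real p) \<ge> 1"
    using ev_n ev_pos ev_small by eventually_elim (auto intro!: C_oracle_ge_1)
  moreover have "\<forall>\<^sub>F n in sequentially.
        is_arg_min (C_oracle (\<delta> n) n) (\<lambda>p. p \<in> {1..real n - 1}) (pstar n) \<and>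
        (\<forall>q\<in>{1..n - 1}.
           is_arg_min (\<lambda>p. C_oracle (\<delta> n) n (real p)) (\<lambda>p. p \<in> {1..n - 1}) q
             \<longrightarrow> \<bar>real q - pstar n\<bar> < 1) \<and>
        0 < pstar n / real n \<and>
        pstar n / real n =
          1 - (1 - 5 * \<delta> n + 4 * (\<delta> n)\<^sup>2 - 2 / (real n - 1) * (3 * \<delta> n - 4 * (\<delta> n)\<^sup>2)
                 + \<delta> n / (real n - 1))
              / (1 + 2 * (1 + 1 / (real n - 1)) * (3 * \<delta> n - 4 * (\<delta> n)\<^sup>2)
                 - \<delta> n * (1 + 1 / (real n - 1))) \<and>
        pstar n / real n < 1"
    using ev_n ev_pos ev_small ev_ge ev_le
  proof eventually_elim
    case (elim n)
    have "pstar n / real n = 1 - crossing_num (\<delta> n) n / crossing_den (\<delta> n) n"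
      using elim(1) by (simp add: pstar_def p_opt_def)
    moreover have "0 < pstar n / real n" "pstar n / real n < 1"
      using elim by (auto simp: pos_divide_less_eq)
    ultimately show ?case
      using C_oracle_valley[OF elim(2,3,1) elim(4,5)[unfolded pstar_def]]
      unfolding pstar_def crossing_num_def crossing_den_def by blast
  qed
  ultimately show ?thesis
    using ratio_0 equiv pstar_top by blast
qed

end
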